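(* Let $\Phi$ be a root system of type $D_\ell$ ($\ell\ge4$), $j=1$ and $\omega=\omega_1$. Then the set $\Phi_{\omega,0}^+=\{\beta\in\Phi^+:\beta^\omega=0\}$ is $$\Phi_{\omega,0}^+=\{e_1-e_\ell,\ e_1+e_\ell\}=\{\alpha_1+\cdots+\alpha_{\ell-1},\ \ \alpha_1+\cdots+\alpha_{\ell-2}+\alpha_\ell\}.$$ Hence $P(0)=\{\pm1\}$.
   Context: Realize $\Phi$ of type $D_\ell$ in $E=\mathbb{R}^\ell$ with standard basis $e_1,\dots,e_\ell$ as $\{\pm e_p\pm e_q:p<q\}$, with basis $\Delta$: $\alpha_i=e_i-e_{i+1}$ ($1\le i\le\ell-1$), $\alpha_\ell=e_{\ell-1}+e_\ell$; $\Phi^+$ is the corresponding set of positive roots. Let $\tilde\alpha=\sum_{i=1}^\ell n_i\alpha_i$ be the highest root, $\alpha_0=-\tilde\alpha$, $n_0=1$; then $J=\{i\in\{0,\dots,\ell\}:n_i=1\}=\{0,1,\ell-1,\ell\}$. Let $w_0$ be the longest element of the Weyl group $W$, $w_1$ the longest element of the subgroup generated by $s_{\alpha_2},\dots,s_{\alpha_\ell}$, and $\omega=\omega_1=w_1w_0$; it acts on $\{\alpha_0,\dots,\alpha_\ell\}$ by the index permutation $\sigma=(0\ 1)(\ell-1\ \ \ell)$. Put $x^\omega=\frac1{o(\omega)}\sum_{t=1}^{o(\omega)}\omega^t(x)$ with $o(\omega)=2$ the order of $\omega$. Let $\varpi_1^\vee,\dots,\varpi_\ell^\vee$ be the dual basis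 of $\Delta$, $\varpi_0^\vee=0$, and $\pi_0^1=\varpi_0^\vee+\varpi_1^\vee$ the sum over the $\langle\sigma\rangle$-orbit of $0$. Put $P(0)=\{(\gamma,\pi_0^1):\gamma\in\Phi,\ \gamma^\omega=0\}$. *)

theory Defs
  imports
    "HOL-Analysis.Analysis"
    "HOL-Algebra.Bij"
    "HOL-Algebra.Generated_Groups"
    "HOL-Algebra.Multiplicative_Group"
    "HOL-Combinatorics.Orbits"
begin

text \<open>
  The rank is \<open>CARD('n)\<close>. In all definitions, \<open>e 1, \<dots>, e (CARD('n))\<close> is meant to be the standard
  basis of \<open>real ^ 'n\<close>, listed in some order: the index type itself need not be ordered.
\<close>

lemma standard_basis_labelling_exists:
  "\<exists>e :: nat \<Rightarrow> real ^ 'n. bij_betw e {1..CARD('n)} Basis"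
proof -
  have "card (Basis :: (real ^ 'n) set) = CARD('n)"
    by simp
  then show ?thesis
    using ex_bij_betw_nat_finite_1[OF finite_Basis] by metis
qed

definition roots_D :: "(nat \<Rightarrow> real ^ 'n) \<Rightarrow> (real ^ 'n) set" where
  "roots_D e = (\<Union>(p, q) \<in> {(p, q). 1 \<le> p \<and> p < q \<and> q \<le> CARD('n)}.
     {e p + e q, e p - e q, - e p + e q, - e p - e q})"

definition simple_root :: "(nat \<Rightarrow> real ^ 'n) \<Rightarrow> nat \<Rightarrow> real ^ 'n" where
  "simple_root e i =
     (if i < CARD('n) then e i - e (i + 1) else e (CARD('n) - 1) + e (CARD('n)))"

definition nonneg_combinations :: "(nat \<Rightarrow> real ^ 'n) \<Rightarrow> (real ^ 'n) set" where
  "nonneg_combinations e =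
     {\<Sum>i = 1..CARD('n). real (c i) *\<^sub>R simple_root e i | c :: nat \<Rightarrow> nat. True}"

definition positive_roots :: "(nat \<Rightarrow> real ^ 'n) \<Rightarrow> (real ^ 'n) set" where
  "positive_roots e = roots_D e \<inter> nonneg_combinations e"

definition highest_root :: "(nat \<Rightarrow> real ^ 'n) \<Rightarrow> real ^ 'n" where
  "highest_root e =
     (THE \<theta>. \<theta> \<in> roots_D e \<and> (\<forall>\<beta> \<in> roots_D e. \<theta> - \<beta> \<in> nonneg_combinations e))"

definition affine_root :: "(nat \<Rightarrow> real ^ 'n) \<Rightarrow> nat \<Rightarrow> real ^ 'n" where
  "affine_root e i = (if i = 0 then - highest_root e else simple_root e i)"

definition reflection :: "'a::real_inner \<Rightarrow> 'a \<Rightarrow> 'a" where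
  "reflection a x = x - (2 * (x \<bullet> a) / (a \<bullet> a)) *\<^sub>R a"

text \<open>Groups of transformations are subgroups of \<open>BijGroup UNIV\<close>, whose product is composition.\<close>

definition Weyl_group :: "(nat \<Rightarrow> real ^ 'n) \<Rightarrow> (real ^ 'n \<Rightarrow> real ^ 'n) set" where
  "Weyl_group e = generate (BijGroup UNIV) (reflection ` roots_D e)"

definition parabolic_subgroup ::
    "(nat \<Rightarrow> real ^ 'n) \<Rightarrow> nat set \<Rightarrow> (real ^ 'n \<Rightarrow> real ^ 'n) set" where
  "parabolic_subgroup e I =
     generate (BijGroup UNIV) ((\<lambda>i. reflection (simple_root e i)) ` I)"

definition word_length :: "(nat \<Rightarrow> real ^ 'n) \<Rightarrow> (real ^ 'n \<Rightarrow> real ^ 'n) \<Rightarrow> nat" where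
  "word_length e w =
     (LEAST k. \<exists>js. length js = k \<and> set js \<subseteq> {1..CARD('n)} \<and>
        w = foldr (\<lambda>i f. reflection (simple_root e i) \<circ> f) js id)"

definition longest_element ::
    "(nat \<Rightarrow> real ^ 'n) \<Rightarrow> (real ^ 'n \<Rightarrow> real ^ 'n) set \<Rightarrow> (real ^ 'n \<Rightarrow> real ^ 'n)" where
  "longest_element e H =
     (THE w. w \<in> H \<and> (\<forall>v \<in> H. word_length e v \<le> word_length e w))"

definition omega :: "(nat \<Rightarrow> real ^ 'n) \<Rightarrow> nat \<Rightarrow> (real ^ 'n \<Rightarrow> real ^ 'n)" where
  "omega e j =
     longest_element e (parabolic_subgroup e ({1..CARD('n)} - {j})) \<circ>
     longest_element e (Weyl_group e)"

definition average :: "(real ^ 'n \<Rightarrow> real ^ 'n) \<Rightarrow> real ^ 'n \<Rightarrow> real ^ 'n" where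
  "average f x =
     (let m = group.ord (BijGroup UNIV) f in (1 / real m) *\<^sub>R (\<Sum>t = 1..m. (f ^^ t) x))"

definition index_perm ::
    "(nat \<Rightarrow> real ^ 'n) \<Rightarrow> (real ^ 'n \<Rightarrow> real ^ 'n) \<Rightarrow> nat \<Rightarrow> nat" where
  "index_perm e f i =
     (if i \<le> CARD('n)
      then THE k. k \<le> CARD('n) \<and> f (affine_root e i) = affine_root e k
      else i)"

definition coweight :: "(nat \<Rightarrow> real ^ 'n) \<Rightarrow> nat \<Rightarrow> real ^ 'n" where
  "coweight e k =
     (if k = 0 then 0
      else THE v. \<forall>i \<in> {1..CARD('n)}. v \<bullet> simple_root e i = (if i = k then 1 else 0))"

text \<open>The set of forward iterates \<open>orbit \<sigma> 0\<close> is the orbit of the cyclic group generated by \<open>\<sigma>\<close>,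
  since \<open>\<sigma>\<close> has finite order.\<close>

definition pi0 :: "(nat \<Rightarrow> real ^ 'n) \<Rightarrow> nat \<Rightarrow> real ^ 'n" where
  "pi0 e j = (\<Sum>k \<in> orbit (index_perm e (omega e j)) 0. coweight e k)"

definition positive_roots_average_zero :: "(nat \<Rightarrow> real ^ 'n) \<Rightarrow> nat \<Rightarrow> (real ^ 'n) set" where
  "positive_roots_average_zero e j = {\<beta> \<in> positive_roots e. average (omega e j) \<beta> = 0}"

definition P0 :: "(nat \<Rightarrow> real ^ 'n) \<Rightarrow> nat \<Rightarrow> real set" where
  "P0 e j = {\<gamma> \<bullet> pi0 e j | \<gamma>. \<gamma> \<in> roots_D e \<and> average (omega e j) \<gamma> = 0}"

end

theory Submission
  imports Defs
begin

text \<open>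
  Everything follows from one formula: \<open>\<omega>\<close> negates the first and the last coordinate and fixes all
  others (\<open>omega_eq\<close>). Then \<open>\<omega>\<close> has order two, averaging over \<open>\<omega>\<close> erases exactly the coordinates
  \<open>1\<close> and \<open>l\<close>, and the roots with vanishing average are the four vectors \<open>\<plusminus>e 1 \<plusminus> e l\<close>. Their signs and
  their pairings with \<open>\<pi>\<^sub>0\<^sup>1 = \<varpi>\<^sub>1 = e 1\<close> can be read off.

  The work lies in the two longest elements, which are defined as maximisers of word length in a
  group given by generators. Both groups consist of signed permutations of the basis with an even
  number of sign changes. For such maps the word length is the number of inversions, that is, of
  positive roots made negative (\<open>word_length_eq_card_inversions\<close>): multiplying on the right by
  a simple reflection changes the number of inversions by exactly one, the direction being given by the sign
  of the image of the simple root, and a map without any negative such image is the identity.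
  Consequently an element of maximal length in a parabolic subgroup makes every simple root of that
  subgroup negative. The rigidity lemma \<open>even_signed_rigid\<close> shows that this determines the element: it negates
  the coordinates on which the subgroup acts, except that the last coordinate keeps its sign if
  this is needed to make the number of sign changes even. For \<open>w\<^sub>0\<close> the subgroup acts on \<open>l\<close>
  coordinates and for \<open>w\<^sub>1\<close> on \<open>l - 1\<close>; these numbers have opposite parity, so exactly one of
  the two elements negates \<open>e l\<close>, and the product negates \<open>e 1\<close> and \<open>e l\<close> only.

  Positivity is measured by the height, the inner product with the half sum \<open>\<rho>\<close> of the positive
  roots. It is an integer, nonzero on roots and equal to \<open>1\<close> on simple roots, so that questions
  about signs of roots become linear arithmetic.
\<close>

(* The index 1 occurs as an argument of e throughout; rewriting it to Suc 0 would stop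
   facts about e 1 from applying. *)
declare One_nat_def [simp del]

section \<open>Subgroups generated by involutions\<close>

lemma bij_involution:
  fixes g :: "'a \<Rightarrow> 'a"
  assumes "g \<circ> g = id"
  shows "bij g"
  using assms o_bij by blast

lemma BijGroup_UNIV_mult:
  assumes "bij f" "bij g"
  shows "f \<otimes>\<^bsub>BijGroup UNIV\<^esub> g = f \<circ> g"
  using assms by (auto simp: BijGroup_def Bij_def extensional_def compose_def restrict_def fun_eq_iff)

lemma BijGroup_UNIV_one: "\<one>\<^bsub>BijGroup UNIV\<^esub> = id"
  by (auto simp: BijGroup_def fun_eq_iff)

lemma carrier_BijGroup_UNIV: "f \<in> carrier (BijGroup UNIV) \<longleftrightarrow> bij f"
  by (auto simp: BijGroup_def Bij_def extensional_def)

text \<open>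
  Inverses can be dropped from the induction over a generated subgroup, since each generator is its
  own inverse. Bijectivity is carried along because the product of \<open>BijGroup UNIV\<close> is composition
  only on its carrier.
\<close>

lemma generate_involutions_induct:
  assumes w: "w \<in> generate (BijGroup UNIV) A"
    and invol: "\<And>g. g \<in> A \<Longrightarrow> g \<circ> g = id"
    and id: "P id" and gen: "\<And>g. g \<in> A \<Longrightarrow> P g"
    and comp: "\<And>f g. P f \<Longrightarrow> P g \<Longrightarrow> P (f \<circ> g)"
  shows "P w \<and> bij w"
  using w
proof induction
  case one
  have "P id \<and> bij id" using id by blast
  then show ?case by (simp only: BijGroup_UNIV_one)
next
  case (incl h)
  then show ?case by (simp add: gen bij_involution invol)
next
  case (inv h)
  interpret group "BijGroup (UNIV :: 'a set)" by (rule group_BijGroup)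
  have h: "bij h" using inv by (simp add: bij_involution invol)
  have "h \<otimes>\<^bsub>BijGroup UNIV\<^esub> h = \<one>\<^bsub>BijGroup UNIV\<^esub>"
    using inv by (simp add: BijGroup_UNIV_mult h BijGroup_UNIV_one invol)
  then have "inv\<^bsub>BijGroup UNIV\<^esub> h = h"
    using h by (intro inv_equality) (auto simp: carrier_BijGroup_UNIV)
  then show ?case using inv by (simp add: gen h)
next
  case (eng h1 h2)
  then have "P (h1 \<circ> h2) \<and> bij (h1 \<circ> h2)" using comp bij_comp by blast
  then show ?case using eng by (simp only: BijGroup_UNIV_mult)
qed

lemma generate_involutions_comp:
  assumes w: "w \<in> generate (BijGroup UNIV) A" and g: "g \<in> A"
    and invol: "\<And>g. g \<in> A \<Longrightarrow> g \<circ> g = id"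
  shows "w \<circ> g \<in> generate (BijGroup UNIV) A"
proof -
  have "bij w"
    using generate_involutions_induct[OF w invol, of "\<lambda>_. True"] by blast
  then have "w \<otimes>\<^bsub>BijGroup UNIV\<^esub> g = w \<circ> g"
    by (intro BijGroup_UNIV_mult) (auto intro: bij_involution invol g)
  then show ?thesis
    using generate.eng[OF w generate.incl[OF g]] by simp
qed

section \<open>Coordinates, roots and heights\<close>

locale D_type =
  fixes e :: "nat \<Rightarrow> real ^ 'n" and l :: nat
  assumes rank: "CARD('n) = l" and rank_ge: "4 \<le> l"
    and basis: "bij_betw e {1..l} Basis"
begin

lemma e_inner [simp]:
  assumes "1 \<le> i" "i \<le> l" "1 \<le> j" "j \<le> l"
  shows "e i \<bullet> e j = (if i = j then 1 else 0)"
proof -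
  have "e i \<in> Basis" "e j \<in> Basis"
    using basis assms unfolding bij_betw_def by auto
  moreover have "e i = e j \<longleftrightarrow> i = j"
    using inj_on_eq_iff[OF bij_betw_imp_inj_on[OF basis], of i j] assms by simp
  ultimately show ?thesis by (simp add: inner_Basis)
qed

lemma basis_eqI:
  assumes "\<And>i. 1 \<le> i \<Longrightarrow> i \<le> l \<Longrightarrow> x \<bullet> e i = y \<bullet> e i"
  shows "x = y"
proof (rule euclidean_eqI)
  fix b :: "real ^ 'n" assume "b \<in> Basis"
  then obtain i where "i \<in> {1..l}" "b = e i"
    using basis unfolding bij_betw_def by blast
  then show "x \<bullet> b = y \<bullet> b" using assms by simp
qed

lemma linear_basis_eqI:
  assumes "linear f" "linear g" "\<And>i. 1 \<le> i \<Longrightarrow> i \<le> l \<Longrightarrow> f (e i) = g (e i)"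
  shows "f = g"
proof (rule linear_eq_stdbasis)
  fix b :: "real ^ 'n" assume "b \<in> Basis"
  then obtain i where "i \<in> {1..l}" "b = e i"
    using basis unfolding bij_betw_def by blast
  then show "f b = g b" using assms by simp
qed (use assms in auto)

text \<open>
  Signs as scalars let linear maps and inner products act on all four kinds of roots uniformly.
\<close>

lemma root_iff:
  "\<beta> \<in> roots_D e \<longleftrightarrow>
    (\<exists>p q s t. 1 \<le> p \<and> p < q \<and> q \<le> l \<and> s \<in> {1, -1} \<and> t \<in> {1, -1} \<and>
       \<beta> = s *\<^sub>R e p + t *\<^sub>R e q)"
  (is "_ \<longleftrightarrow> ?R")
proof
  assume "\<beta> \<in> roots_D e"
  then obtain p q where pq: "1 \<le> p" "p < q" "q \<le> l"
    and "\<beta> \<in> {e p + e q, e p - e q, - e p + e q, - e p - e q}"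
    by (auto simp: roots_D_def rank)
  then have "\<exists>s \<in> {1, -1}. \<exists>t \<in> {1, -1}. \<beta> = s *\<^sub>R e p + t *\<^sub>R e q"
    by auto
  then show ?R using pq by blast
next
  assume ?R
  then show "\<beta> \<in> roots_D e"
    by (fastforce simp: roots_D_def rank)
qed

lemma rootI:
  assumes "1 \<le> p" "p \<le> l" "1 \<le> q" "q \<le> l" "p \<noteq> q" "s \<in> {1, -1}" "t \<in> {1, -1}"
  shows "s *\<^sub>R e p + t *\<^sub>R e q \<in> roots_D e"
proof (cases "p < q")
  case True
  then show ?thesis using assms unfolding root_iff by blast
next
  case False
  then show ?thesis using assms unfolding root_iff
    by (intro exI[of _ q] exI[of _ p] exI[of _ t] exI[of _ s]) (simp add: add.commute)
qed

lemma finite_roots: "finite (roots_D e)"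
proof -
  have "finite {(p, q). 1 \<le> p \<and> p < q \<and> q \<le> l}"
    by (rule finite_subset[of _ "{1..l} \<times> {1..l}"]) auto
  then show ?thesis by (auto simp: roots_D_def rank)
qed

text \<open>
  This is the half sum of the positive roots of \<open>D\<^sub>l\<close>, so that the inner product with it is the
  height of a root.
\<close>

definition rho :: "real ^ 'n" where
  "rho = (\<Sum>i = 1..l. (real l - real i) *\<^sub>R e i)"

lemma rho_e [simp]:
  assumes "1 \<le> i" "i \<le> l"
  shows "rho \<bullet> e i = real l - real i"
proof -
  have "rho \<bullet> e i = (\<Sum>j = 1..l. (real l - real j) * (if j = i then 1 else 0))"
    unfolding rho_def inner_sum_left using assms by (intro sum.cong) auto
  also have "\<dots> = (\<Sum>j = 1..l. if j = i then real l - real j else 0)"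
    by (intro sum.cong) auto
  also have "\<dots> = real l - real i" using assms by simp
  finally show ?thesis .
qed

lemma rho_root_Ints: "\<beta> \<in> roots_D e \<Longrightarrow> rho \<bullet> \<beta> \<in> \<int>"
  unfolding root_iff by (auto simp: inner_simps)

lemma rho_root_nonzero: "\<beta> \<in> roots_D e \<Longrightarrow> rho \<bullet> \<beta> \<noteq> 0"
  unfolding root_iff by (auto simp: inner_simps)

lemma root_norm: "\<beta> \<in> roots_D e \<Longrightarrow> \<beta> \<bullet> \<beta> = 2"
  unfolding root_iff by (auto simp: inner_simps)

lemma root_inner_Ints:
  assumes "\<beta> \<in> roots_D e" "\<gamma> \<in> roots_D e"
  shows "\<beta> \<bullet> \<gamma> \<in> \<int>"
proof -
  from assms obtain p q s t p' q' s' t' where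
    p: "1 \<le> p" "p < q" "q \<le> l" "1 \<le> p'" "p' < q'" "q' \<le> l"
    and "s \<in> {1, -1}" "t \<in> {1, -1}" "s' \<in> {1, -1}" "t' \<in> {1, -1}"
    and eqs: "\<beta> = s *\<^sub>R e p + t *\<^sub>R e q" "\<gamma> = s' *\<^sub>R e p' + t' *\<^sub>R e q'"
    unfolding root_iff by metis
  then have st: "s \<in> \<int>" "t \<in> \<int>" "s' \<in> \<int>" "t' \<in> \<int>" by auto
  have "e i \<bullet> e j \<in> \<int>" if "1 \<le> i" "i \<le> l" "1 \<le> j" "j \<le> l" for i j
    using that by simp
  then show ?thesis
    unfolding eqs inner_add_left inner_add_right inner_scaleR_left inner_scaleR_right
    using p st by (intro Ints_add Ints_mult) auto
qed

lemma reflection_root: "a \<in> roots_D e \<Longrightarrow> reflection a x = x - (x \<bullet> a) *\<^sub>R a"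
  by (simp add: reflection_def root_norm)

lemma reflection_involution:
  assumes a: "a \<in> roots_D e"
  shows "reflection a \<circ> reflection a = id"
proof
  fix x
  have "(x - (x \<bullet> a) *\<^sub>R a) \<bullet> a = - (x \<bullet> a)"
    by (simp add: inner_diff_left root_norm[OF a])
  then show "(reflection a \<circ> reflection a) x = id x"
    by (simp add: reflection_root[OF a])
qed

lemma simple_root_less: "i < l \<Longrightarrow> simple_root e i = e i - e (Suc i)"
  and simple_root_last: "simple_root e l = e (l - 1) + e l"
  by (simp_all add: simple_root_def rank Suc_eq_plus1)

lemma simple_root_in:
  assumes "1 \<le> i" "i \<le> l"
  shows "simple_root e i \<in> roots_D e"
proof (cases "i < l")
  case True
  then show ?thesis
    using rootI[of i "Suc i" 1 "-1"] assms by (simp add: simple_root_less)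
next
  case False
  then have "i = l" using assms by simp
  then show ?thesis
    using rootI[of "l - 1" l 1 1] rank_ge by (simp add: simple_root_last)
qed

lemma rho_simple_root:
  assumes "1 \<le> i" "i \<le> l"
  shows "rho \<bullet> simple_root e i = 1"
proof (cases "i < l")
  case False
  then have "i = l" using assms by simp
  then show ?thesis using rank_ge by (simp add: simple_root_last inner_simps)
qed (use assms in \<open>simp add: simple_root_less inner_simps\<close>)

section \<open>Even signed permutations\<close>

definition signed_basis :: "(real ^ 'n) set" where
  "signed_basis = {c *\<^sub>R e i | c i. 1 \<le> i \<and> i \<le> l \<and> c \<in> {1, -1}}"

text \<open>
  These three invariants characterise the Weyl group of type \<open>D\<^sub>l\<close> among all maps: the first two give
  signed permutations of the basis, and such a map preserves the product of the coordinates exactly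
  if the number of its sign changes is even. All three are visibly stable under composition, which
  makes them convenient for groups given by generators.
\<close>

definition even_signed :: "(real ^ 'n \<Rightarrow> real ^ 'n) \<Rightarrow> bool" where
  "even_signed w \<longleftrightarrow> orthogonal_transformation w \<and> w ` signed_basis \<subseteq> signed_basis \<and>
     (\<forall>x. (\<Prod>i = 1..l. w x \<bullet> e i) = (\<Prod>i = 1..l. x \<bullet> e i))"

lemma even_signed_id: "even_signed id"
  by (simp add: even_signed_def orthogonal_transformation_def linear_id)

lemma even_signed_comp: "even_signed f \<Longrightarrow> even_signed g \<Longrightarrow> even_signed (f \<circ> g)"
  by (auto simp: even_signed_def orthogonal_transformation_compose image_subset_iff)

lemma even_signed_linear: "even_signed w \<Longrightarrow> linear w"
  and even_signed_inner: "even_signed w \<Longrightarrow> w x \<bullet> w y = x \<bullet> y"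
  by (auto simp: even_signed_def orthogonal_transformation_def)

lemma even_signed_e:
  assumes "even_signed w" "1 \<le> i" "i \<le> l"
  obtains c j where "w (e i) = c *\<^sub>R e j" "1 \<le> j" "j \<le> l" "c \<in> {1, -1}"
proof -
  have "e i \<in> signed_basis"
    using assms unfolding signed_basis_def by (intro CollectI exI[of _ 1] exI[of _ i]) auto
  then have "w (e i) \<in> signed_basis"
    using assms by (auto simp: even_signed_def)
  then show ?thesis using that unfolding signed_basis_def by blast
qed

lemma even_signed_root:
  assumes w: "even_signed w" and "\<beta> \<in> roots_D e"
  shows "w \<beta> \<in> roots_D e"
proof -
  from assms obtain p q s t where pq: "1 \<le> p" "p < q" "q \<le> l"
    and st: "s \<in> {1, -1}" "t \<in> {1, -1}" and \<beta>: "\<beta> = s *\<^sub>R e p + t *\<^sub>R e q"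
    unfolding root_iff by blast
  obtain c i where c: "w (e p) = c *\<^sub>R e i" "1 \<le> i" "i \<le> l" "c \<in> {1, -1}"
    using even_signed_e[OF w, of p] pq by auto
  obtain d j where d: "w (e q) = d *\<^sub>R e j" "1 \<le> j" "j \<le> l" "d \<in> {1, -1}"
    using even_signed_e[OF w, of q] pq by auto
  have "w (e p) \<bullet> w (e q) = 0"
    using pq by (simp add: even_signed_inner[OF w])
  then have "i \<noteq> j" using c d by auto
  have "w \<beta> = (s * c) *\<^sub>R e i + (t * d) *\<^sub>R e j"
    using even_signed_linear[OF w] c d by (simp add: \<beta> linear_add linear_scale)
  moreover have "\<dots> \<in> roots_D e"
    using c d st \<open>i \<noteq> j\<close> by (intro rootI) auto
  ultimately show ?thesis by simp
qed

lemma even_signed_reflection: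
  assumes "a \<in> roots_D e"
  shows "even_signed (reflection a)"
proof -
  from assms obtain p q s t where pq: "1 \<le> p" "p < q" "q \<le> l"
    and st: "s \<in> {1, -1}" "t \<in> {1, -1}" and a: "a = s *\<^sub>R e p + t *\<^sub>R e q"
    unfolding root_iff by blast
  have coord: "reflection a x \<bullet> e i =
      (if i = p then - (s * t) * (x \<bullet> e q) else if i = q then - (s * t) * (x \<bullet> e p) else x \<bullet> e i)"
    if "1 \<le> i" "i \<le> l" for x i
  proof -
    have "reflection a x \<bullet> e i = x \<bullet> e i - (x \<bullet> a) * (a \<bullet> e i)"
      by (simp add: reflection_root[OF assms] inner_diff_left)
    moreover have "x \<bullet> a = s * (x \<bullet> e p) + t * (x \<bullet> e q)"
      by (simp add: a inner_add_right)
    moreover have "a \<bullet> e i = (if i = p then s else if i = q then t else 0)"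
      using that pq by (auto simp: a inner_add_left)
    ultimately show ?thesis using st pq by auto
  qed
  have "orthogonal_transformation (reflection a)"
    unfolding orthogonal_transformation_def
  proof (intro conjI allI)
    show "linear (reflection a)"
      by (rule linearI)
        (simp_all add: reflection_root[OF assms] inner_add_left scaleR_add_left scaleR_diff_right)
    show "reflection a x \<bullet> reflection a y = x \<bullet> y" for x y
      by (simp add: reflection_root[OF assms] inner_diff_left inner_diff_right root_norm[OF assms]
          inner_commute[of a y])
  qed
  moreover have "reflection a (c *\<^sub>R e i) \<in> signed_basis"
    if i: "1 \<le> i" "i \<le> l" and c: "c \<in> {1, -1}" for c i
  proof -
    define d where "d = (if i \<in> {p, q} then - (s * t) * c else c)"
    define j where "j = (if i = p then q else if i = q then p else i)"
    have "reflection a (c *\<^sub>R e i) = d *\<^sub>R e j"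
      using i pq by (intro basis_eqI) (auto simp: coord d_def j_def)
    moreover have "d \<in> {1, -1}" "1 \<le> j" "j \<le> l"
      using st c i pq by (auto simp: d_def j_def)
    ultimately show ?thesis unfolding signed_basis_def by blast
  qed
  then have "reflection a ` signed_basis \<subseteq> signed_basis"
    by (auto simp: signed_basis_def[of, THEN equalityD1, THEN subsetD] signed_basis_def)
  moreover have "(\<Prod>i = 1..l. reflection a x \<bullet> e i) = (\<Prod>i = 1..l. x \<bullet> e i)" for x
  proof -
    have split: "(\<Prod>i = 1..l. f i) = f p * f q * (\<Prod>i \<in> {1..l} - {p} - {q}. f i)"
      for f :: "nat \<Rightarrow> real"
      using pq by (simp add: prod.remove[of "{1..l}" p] prod.remove[of "{1..l} - {p}" q])
    have "(\<Prod>i \<in> {1..l} - {p} - {q}. reflection a x \<bullet> e i) = (\<Prod>i \<in> {1..l} - {p} - {q}. x \<bullet> e i)"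
      by (intro prod.cong) (auto simp: coord)
    then show ?thesis
      using pq st unfolding split by (auto simp: coord)
  qed
  ultimately show ?thesis by (simp add: even_signed_def)
qed

text \<open>
  With \<open>f i = s * (\<rho> \<bullet> w (e i))\<close>, the sign conditions on \<open>\<alpha>\<^sub>k, \<dots>, \<alpha>\<^bsub>l - 1\<^esub>\<close> say that the
  integers \<open>f k > \<dots> > f l\<close> decrease strictly, and the one on \<open>\<alpha>\<^sub>l\<close> says that \<open>f (l - 1) + f l > 0\<close>.
  Hence \<open>f (l - 1) \<ge> 1\<close>. As \<open>w\<close> fixes \<open>e i\<close> for \<open>i < k\<close>, it maps \<open>e k\<close> to some \<open>\<plusminus>e j\<close> with
  \<open>j \<ge> k\<close>, so \<open>f k \<le> l - k\<close>. There is no room left: \<open>f i = l - i\<close> for \<open>k \<le> i < l\<close>, which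
  identifies \<open>w (e i)\<close>. Only the sign of \<open>w (e l)\<close> is then open, and parity decides it.
\<close>

lemma even_signed_rigid:
  assumes w: "even_signed w" and k: "1 \<le> k" "k < l" and s: "s \<in> {1, -1}"
    and fixed: "\<And>i. 1 \<le> i \<Longrightarrow> i < k \<Longrightarrow> w (e i) = e i"
    and sign: "\<And>i. k \<le> i \<Longrightarrow> i \<le> l \<Longrightarrow> 0 < s * (rho \<bullet> w (simple_root e i))"
  shows "\<And>i. k \<le> i \<Longrightarrow> i < l \<Longrightarrow> w (e i) = s *\<^sub>R e i"
    and "w (e l) = s ^ (l - k) *\<^sub>R e l"
proof -
  define f where "f i = s * (rho \<bullet> w (e i))" for i
  note lin = even_signed_linear[OF w]
  have f_Ints: "f i \<in> \<int>" if i: "1 \<le> i" "i \<le> l" for i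
  proof -
    obtain c j where "w (e i) = c *\<^sub>R e j" "1 \<le> j" "j \<le> l" "c \<in> {1, -1}"
      using even_signed_e[OF w i] .
    then show ?thesis using s by (auto simp: f_def)
  qed
  have f_step: "f (Suc i) + 1 \<le> f i" if i: "k \<le> i" "i < l" for i
  proof -
    have "0 < f i - f (Suc i)"
      using sign[of i] i by (simp add: f_def simple_root_less linear_diff[OF lin] inner_simps algebra_simps)
    moreover have "f i - f (Suc i) \<in> \<int>" using f_Ints i k by simp
    ultimately show ?thesis using Ints_nonzero_abs_ge1[of "f i - f (Suc i)"] by simp
  qed
  have "0 < f (l - 1) + f l"
    using sign[of l] k by (simp add: f_def simple_root_last linear_add[OF lin] inner_simps algebra_simps)
  moreover have "k \<le> l - 1" using k by linarith
  then have "f l + 1 \<le> f (l - 1)" using f_step[of "l - 1"] k by simp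
  ultimately have "0 < f (l - 1)" by linarith
  then have base: "1 \<le> f (l - 1)"
    using Ints_nonzero_abs_ge1[OF f_Ints[of "l - 1"]] k by simp
  have lower: "real l - real i \<le> f i" if i: "k \<le> i" "i \<le> l - 1" for i
    using i(2,1)
  proof (induction i rule: inc_induct)
    case base
    then show ?case using \<open>1 \<le> f (l - 1)\<close> k by simp
  next
    case (step i)
    have "f (Suc i) + 1 \<le> f i" by (intro f_step) (use step in linarith)+
    then show ?case using step by simp
  qed
  have upper: "f i \<le> real l - real i" if "k \<le> i" "i \<le> l - 1" for i
    using that
  proof (induction i rule: dec_induct)
    case base
    obtain c j where j: "w (e k) = c *\<^sub>R e j" "1 \<le> j" "j \<le> l" "c \<in> {1, -1}"
      using even_signed_e[OF w, of k] k by auto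
    have "k \<le> j"
    proof (rule ccontr)
      assume "\<not> k \<le> j"
      then have "w (e k) \<bullet> w (e j) = 0"
        using j(2,3) k by (simp add: even_signed_inner[OF w])
      moreover have "w (e k) \<bullet> w (e j) = c"
        using j(1-3) fixed[of j] \<open>\<not> k \<le> j\<close> by simp
      ultimately show False using j(4) by auto
    qed
    then show ?case using j s by (auto simp: f_def)
  next
    case (step i)
    have "f (Suc i) + 1 \<le> f i" by (intro f_step) (use step in linarith)+
    then show ?case using step by simp
  qed
  show we: "w (e i) = s *\<^sub>R e i" if i: "k \<le> i" "i < l" for i
  proof -
    obtain c j where j: "w (e i) = c *\<^sub>R e j" "1 \<le> j" "j \<le> l" "c \<in> {1, -1}"
      using even_signed_e[OF w, of i] k i by auto
    have "i \<le> l - 1" using i by linarith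
    then have "f i = real l - real i" using upper[of i] lower[of i] i by simp
    then have "s * c * (real l - real j) = real l - real i"
      using j by (simp add: f_def)
    then have "s * c = 1 \<and> j = i"
      using s j i by auto
    then show ?thesis using s j by auto
  qed
  obtain c j where j: "w (e l) = c *\<^sub>R e j" "1 \<le> j" "j \<le> l" "c \<in> {1, -1}"
    using even_signed_e[OF w, of l] k by auto
  have "j = l"
  proof (rule ccontr)
    assume "j \<noteq> l"
    then have "w (e l) \<bullet> w (e j) = 0" using j(2,3) k by (simp add: even_signed_inner[OF w])
    moreover have "w (e j) = 1 *\<^sub>R e j \<or> w (e j) = s *\<^sub>R e j"
      using fixed[of j] we[of j] j \<open>j \<noteq> l\<close> by (cases "j < k") auto
    then have "w (e l) \<bullet> w (e j) = c \<or> w (e l) \<bullet> w (e j) = c * s"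
      using j(1-3) by (elim disjE) simp_all
    ultimately show False using j(4) s by auto
  qed
  \<comment> \<open>On the vector with all coordinates one, the product invariant is the product of the signs.\<close>
  define x where "x = (\<Sum>i = 1..l. e i)"
  have x: "x \<bullet> e i = 1" if "1 \<le> i" "i \<le> l" for i
  proof -
    have "x \<bullet> e i = (\<Sum>j = 1..l. if j = i then 1 else 0)"
      unfolding x_def inner_sum_left using that by (intro sum.cong) auto
    then show ?thesis using that by simp
  qed
  define d where "d i = (if i < k then 1 else if i < l then s else c)" for i
  have d: "w (e i) = d i *\<^sub>R e i" if "1 \<le> i" "i \<le> l" for i
    using that fixed we j \<open>j = l\<close> by (auto simp: d_def)
  have wx: "w x \<bullet> e i = d i" if i: "1 \<le> i" "i \<le> l" for i
  proof -
    have "w x \<bullet> w (e i) = 1" by (simp add: even_signed_inner[OF w] x i)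
    then have "d i * (w x \<bullet> e i) = 1" by (simp add: d i)
    moreover have "d i \<in> {1, -1}" using s j by (auto simp: d_def)
    ultimately show ?thesis by auto
  qed
  have "(\<Prod>i = 1..l. w x \<bullet> e i) = (\<Prod>i = 1..l. x \<bullet> e i)"
    using w by (simp add: even_signed_def)
  then have "(\<Prod>i = 1..l. d i) = 1" by (simp add: wx x)
  also have "(\<Prod>i = 1..l. d i) = (\<Prod>i \<in> {1..<k} \<union> {k..<l} \<union> {l}. d i)"
    using k by (intro prod.cong) auto
  also have "\<dots> = (\<Prod>i \<in> {1..<k}. d i) * (\<Prod>i \<in> {k..<l}. d i) * d l"
    using k by (subst prod.union_disjoint; (subst prod.union_disjoint)?) auto
  also have "\<dots> = s ^ (l - k) * c"
    using k by (simp add: d_def)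
  finally have "s ^ (l - k) * c = 1" .
  then have "c = s ^ (l - k)" using j(4) by auto
  then show "w (e l) = s ^ (l - k) *\<^sub>R e l" using j \<open>j = l\<close> by simp
qed

section \<open>Length and inversions\<close>

abbreviation simple_reflection :: "nat \<Rightarrow> real ^ 'n \<Rightarrow> real ^ 'n" where
  "simple_reflection i \<equiv> reflection (simple_root e i)"

definition inversions :: "(real ^ 'n \<Rightarrow> real ^ 'n) \<Rightarrow> (real ^ 'n) set" where
  "inversions w = {\<beta> \<in> roots_D e. 0 < rho \<bullet> \<beta> \<and> rho \<bullet> w \<beta> < 0}"

lemma finite_inversions: "finite (inversions w)"
  unfolding inversions_def using finite_roots by simp

lemma inversions_id: "inversions id = {}"
  by (auto simp: inversions_def)

lemma even_signed_simple_reflection: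
  "1 \<le> i \<Longrightarrow> i \<le> l \<Longrightarrow> even_signed (simple_reflection i)"
  by (intro even_signed_reflection simple_root_in)

lemma simple_reflection_twice:
  "1 \<le> i \<Longrightarrow> i \<le> l \<Longrightarrow> simple_reflection i (simple_reflection i x) = x"
  using reflection_involution[OF simple_root_in, of i] by (simp add: fun_eq_iff)

lemma simple_reflection_simple_root:
  assumes "1 \<le> i" "i \<le> l"
  shows "simple_reflection i (simple_root e i) = - simple_root e i"
  using root_norm[OF simple_root_in[OF assms]]
  by (simp add: reflection_root[OF simple_root_in[OF assms]] scaleR_2)

text \<open>
  If \<open>\<beta> \<noteq> \<alpha>\<^sub>i\<close>, then \<open>\<beta> \<bullet> \<alpha>\<^sub>i < 2\<close> because both roots have squared norm two, so the reflection lowers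
  the height of \<open>\<beta>\<close> by at most one. A positive root has height at least one and no root has
  height zero, so the height stays positive.
\<close>

lemma simple_reflection_positive:
  assumes i: "1 \<le> i" "i \<le> l" and \<beta>: "\<beta> \<in> roots_D e" "0 < rho \<bullet> \<beta>" "\<beta> \<noteq> simple_root e i"
  shows "0 < rho \<bullet> simple_reflection i \<beta>"
proof -
  let ?a = "simple_root e i"
  note a = simple_root_in[OF i]
  have "0 < (\<beta> - ?a) \<bullet> (\<beta> - ?a)" using \<beta> by simp
  then have "\<beta> \<bullet> ?a < 2"
    by (simp add: inner_diff_left inner_diff_right root_norm[OF a] root_norm[OF \<beta>(1)]
        inner_commute[of ?a \<beta>])
  moreover have "\<beta> \<bullet> ?a \<in> \<int>" using root_inner_Ints[OF \<beta>(1) a] .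
  ultimately have "\<beta> \<bullet> ?a \<le> 1"
    by (auto elim!: Ints_cases)
  moreover have "1 \<le> rho \<bullet> \<beta>"
    using Ints_nonzero_abs_ge1[OF rho_root_Ints[OF \<beta>(1)]] \<beta> by simp
  moreover have "rho \<bullet> simple_reflection i \<beta> = rho \<bullet> \<beta> - \<beta> \<bullet> ?a"
    by (simp add: reflection_root[OF a] inner_simps rho_simple_root i)
  moreover have "rho \<bullet> simple_reflection i \<beta> \<noteq> 0"
    by (rule rho_root_nonzero[OF even_signed_root[OF even_signed_simple_reflection[OF i] \<beta>(1)]])
  ultimately show ?thesis by linarith
qed

text \<open>
  The reflection \<open>s\<^sub>i\<close> permutes the positive roots other than \<open>\<alpha>\<^sub>i\<close>. It therefore carries the
  inversions of \<open>w\<close> to inversions of \<open>w s\<^sub>i\<close>, and \<open>\<alpha>\<^sub>i\<close> is the only new one.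
\<close>

lemma card_inversions_comp_positive:
  assumes w: "even_signed w" and i: "1 \<le> i" "i \<le> l"
    and pos: "0 < rho \<bullet> w (simple_root e i)"
  shows "card (inversions (w \<circ> simple_reflection i)) = Suc (card (inversions w))"
proof -
  let ?a = "simple_root e i" and ?s = "simple_reflection i"
  note twice = simple_reflection_twice[OF i]
  have root: "?s \<beta> \<in> roots_D e" if "\<beta> \<in> roots_D e" for \<beta>
    by (rule even_signed_root[OF even_signed_simple_reflection[OF i] that])
  have nota: "?a \<notin> inversions w" using pos by (simp add: inversions_def)
  have a: "rho \<bullet> ?a = 1" "?s ?a = - ?a" "w (- ?a) = - w ?a"
    using i by (auto simp: rho_simple_root simple_reflection_simple_root
        linear_neg[OF even_signed_linear[OF w]])
  have sa: "?s \<beta> \<noteq> ?a" if "0 < rho \<bullet> \<beta>" for \<beta>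
  proof
    assume "?s \<beta> = ?a"
    then have "\<beta> = - ?a" using twice[of \<beta>] a by simp
    then show False using that a by simp
  qed
  have eq: "inversions (w \<circ> ?s) = insert ?a (?s ` inversions w)"
  proof (intro equalityI subsetI)
    fix \<beta> assume \<beta>: "\<beta> \<in> inversions (w \<circ> ?s)"
    show "\<beta> \<in> insert ?a (?s ` inversions w)"
    proof (cases "\<beta> = ?a")
      case False
      then have "?s \<beta> \<in> inversions w"
        using \<beta> simple_reflection_positive[OF i] by (simp add: inversions_def root)
      then show ?thesis using twice[of \<beta>] by (metis imageI insertI2)
    qed simp
  next
    fix \<beta> assume "\<beta> \<in> insert ?a (?s ` inversions w)"
    then consider "\<beta> = ?a" | \<gamma> where "\<gamma> \<in> inversions w" "\<beta> = ?s \<gamma>" by blast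
    then show "\<beta> \<in> inversions (w \<circ> ?s)"
    proof cases
      case 1
      then show ?thesis using pos simple_root_in[OF i] a by (simp add: inversions_def)
    next
      case 2
      then have "\<gamma> \<noteq> ?a" using nota by auto
      then show ?thesis
        using 2 simple_reflection_positive[OF i, of \<gamma>] by (simp add: inversions_def root twice)
    qed
  qed
  have "?a \<notin> ?s ` inversions w"
  proof
    assume "?a \<in> ?s ` inversions w"
    then obtain \<gamma> where "\<gamma> \<in> inversions w" "?s \<gamma> = ?a" by auto
    then show False using sa[of \<gamma>] by (simp add: inversions_def)
  qed
  moreover have "inj_on ?s (inversions w)" by (rule inj_on_inverseI[of _ ?s]) (rule twice)
  ultimately show ?thesis by (simp add: eq finite_inversions card_image)
qed

lemma card_inversions_comp_negative:
  assumes w: "even_signed w" and i: "1 \<le> i" "i \<le> l"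
    and neg: "rho \<bullet> w (simple_root e i) < 0"
  shows "card (inversions w) = Suc (card (inversions (w \<circ> simple_reflection i)))"
proof -
  let ?u = "w \<circ> simple_reflection i"
  have "even_signed ?u" by (intro even_signed_comp w even_signed_simple_reflection i)
  moreover have "0 < rho \<bullet> ?u (simple_root e i)"
    using neg i by (simp add: simple_reflection_simple_root linear_neg[OF even_signed_linear[OF w]])
  moreover have "?u \<circ> simple_reflection i = w"
    by (simp add: fun_eq_iff simple_reflection_twice i)
  ultimately show ?thesis using card_inversions_comp_positive[of ?u i] i by simp
qed

definition word :: "nat list \<Rightarrow> real ^ 'n \<Rightarrow> real ^ 'n" where
  "word js = foldr (\<lambda>i f. simple_reflection i \<circ> f) js id"

lemma word_Nil: "word [] = id"
  and word_Cons: "word (i # js) = simple_reflection i \<circ> word js"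
  by (simp_all add: word_def)

lemma word_snoc: "word (js @ [i]) = word js \<circ> simple_reflection i"
  by (induction js) (simp_all add: word_Nil word_Cons comp_assoc)

lemma even_signed_word:
  assumes "set js \<subseteq> {1..l}"
  shows "even_signed (word js)"
  using assms
proof (induction js)
  case (Cons i js)
  then show ?case
    unfolding word_Cons by (intro even_signed_comp even_signed_simple_reflection) auto
qed (simp only: word_Nil even_signed_id)

lemma card_inversions_word:
  assumes "set js \<subseteq> {1..l}"
  shows "card (inversions (word js)) \<le> length js"
  using assms
proof (induction js rule: rev_induct)
  case Nil
  show ?case unfolding word_Nil inversions_id by simp
next
  case (snoc i js)
  let ?w = "word js"
  have w: "even_signed ?w" and i: "1 \<le> i" "i \<le> l"
    using snoc.prems by (auto intro: even_signed_word)
  have "rho \<bullet> ?w (simple_root e i) \<noteq> 0"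
    by (rule rho_root_nonzero[OF even_signed_root[OF w simple_root_in[OF i]]])
  then have "card (inversions (word (js @ [i]))) \<le> Suc (card (inversions ?w))"
    unfolding word_snoc
    using card_inversions_comp_positive[OF w i] card_inversions_comp_negative[OF w i]
    by (cases "0 < rho \<bullet> ?w (simple_root e i)") auto
  then show ?case using snoc by simp
qed

text \<open>
  As long as some simple root has a negative image, splitting off its reflection on the right removes
  an inversion. When there is none left, the rigidity lemma with positive sign on all coordinates
  leaves only the identity. This also shows that every such map is a product of simple reflections,
  so the \<open>LEAST\<close> in the definition of word length ranges over a nonempty set.
\<close>

lemma reduced_word_exists:
  assumes "even_signed v"
  shows "\<exists>js. length js = card (inversions v) \<and> set js \<subseteq> {1..l} \<and> v = word js"
  using assms
proof (induction "card (inversions v)" arbitrary: v rule: less_induct)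
  case less
  note v = less.prems
  show ?case
  proof (cases "\<exists>i. 1 \<le> i \<and> i \<le> l \<and> rho \<bullet> v (simple_root e i) < 0")
    case True
    then obtain i where i: "1 \<le> i" "i \<le> l" and neg: "rho \<bullet> v (simple_root e i) < 0" by blast
    let ?u = "v \<circ> simple_reflection i"
    have u: "even_signed ?u" by (intro even_signed_comp v even_signed_simple_reflection i)
    have card: "card (inversions v) = Suc (card (inversions ?u))"
      by (rule card_inversions_comp_negative[OF v i neg])
    then obtain js where js: "length js = card (inversions ?u)" "set js \<subseteq> {1..l}" "?u = word js"
      using less.hyps[OF _ u] by auto
    have "word (js @ [i]) = ?u \<circ> simple_reflection i"
      unfolding js(3) by (rule word_snoc)
    also have "\<dots> = v" by (simp add: fun_eq_iff simple_reflection_twice i)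
    finally show ?thesis
      using js i card by (intro exI[of _ "js @ [i]"]) auto
  next
    case False
    have pos: "0 < 1 * (rho \<bullet> v (simple_root e i))" if i: "1 \<le> i" "i \<le> l" for i
    proof -
      have "\<not> rho \<bullet> v (simple_root e i) < 0" using False i by blast
      then show ?thesis
        using rho_root_nonzero[OF even_signed_root[OF v simple_root_in[OF i]]] by linarith
    qed
    have "v = id"
    proof (rule linear_basis_eqI)
      fix i assume "1 \<le> i" "i \<le> l"
      then show "v (e i) = id (e i)"
        using even_signed_rigid[OF v, of 1 1] pos rank_ge by (cases "i = l") auto
    qed (use even_signed_linear[OF v] in \<open>auto simp: linear_id\<close>)
    then show ?thesis using inversions_id word_Nil by (intro exI[of _ "[]"]) simp
  qed
qed

lemma word_length_eq_card_inversions: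
  assumes "even_signed v"
  shows "word_length e v = card (inversions v)"
  unfolding word_length_def rank word_def[symmetric]
proof (rule Least_equality)
  show "\<exists>js. length js = card (inversions v) \<and> set js \<subseteq> {1..l} \<and> v = word js"
    using reduced_word_exists[OF assms] .
qed (use card_inversions_word in blast)

section \<open>The longest elements and their product\<close>

text \<open>
  Appending a reflection that belongs to \<open>H\<close> to a maximiser cannot increase its length, so the
  maximiser makes the corresponding simple root negative; the rigidity lemma with negative sign then gives its values.
  The same argument shows that any two maximisers agree, and a maximiser exists since lengths
  are bounded by the number of roots. Together this settles the definite description in the
  definition of the longest element, without exhibiting the element as a word in the generators.
\<close>

lemma longest_element_props:
  assumes k: "1 \<le> k" "k < l" and "id \<in> H"
    and even: "\<And>w. w \<in> H \<Longrightarrow> even_signed w"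
    and fixed: "\<And>w i. w \<in> H \<Longrightarrow> 1 \<le> i \<Longrightarrow> i < k \<Longrightarrow> w (e i) = e i"
    and closed: "\<And>w i. w \<in> H \<Longrightarrow> k \<le> i \<Longrightarrow> i \<le> l \<Longrightarrow> w \<circ> simple_reflection i \<in> H"
  shows "longest_element e H \<in> H \<and>
    (\<forall>i \<in> {k..<l}. longest_element e H (e i) = - e i) \<and>
    longest_element e H (e l) = (-1) ^ (l - k) *\<^sub>R e l"
proof -
  let ?P = "\<lambda>w. w \<in> H \<and> (\<forall>v \<in> H. word_length e v \<le> word_length e w)"
  have neg: "0 < - 1 * (rho \<bullet> w (simple_root e i))" if w: "?P w" and i: "k \<le> i" "i \<le> l" for w i
  proof -
    have ew: "even_signed w" and eu: "even_signed (w \<circ> simple_reflection i)"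
      using w i even closed by auto
    have "card (inversions (w \<circ> simple_reflection i)) \<le> card (inversions w)"
      using w i closed[of w i] word_length_eq_card_inversions[OF ew]
        word_length_eq_card_inversions[OF eu] by auto
    then have "\<not> 0 < rho \<bullet> w (simple_root e i)"
      using card_inversions_comp_positive[OF ew, of i] i k by auto
    moreover have "rho \<bullet> w (simple_root e i) \<noteq> 0"
      using rho_root_nonzero[OF even_signed_root[OF ew simple_root_in]] i k by auto
    ultimately show ?thesis by simp
  qed
  have vals: "w (e i) = - e i" if "?P w" "k \<le> i" "i < l" for w i
    using even_signed_rigid(1)[OF even k, of w "-1" i] neg fixed that by auto
  have last: "w (e l) = (-1) ^ (l - k) *\<^sub>R e l" if "?P w" for w
    using even_signed_rigid(2)[OF even k, of w "-1"] neg fixed that by auto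
  have "word_length e w < Suc (card (roots_D e))" if "w \<in> H" for w
    using card_mono[OF finite_roots, of "inversions w"] that
    by (auto simp: word_length_eq_card_inversions even inversions_def less_Suc_eq_le)
  then obtain w where w: "?P w"
    using ex_has_greatest_nat[of "\<lambda>w. w \<in> H" id "word_length e" "Suc (card (roots_D e))"] \<open>id \<in> H\<close>
    by (meson order.strict_implies_order)
  have "u = w" if u: "?P u" for u
  proof (rule linear_basis_eqI)
    fix i assume i: "1 \<le> i" "i \<le> l"
    then consider "i < k" | "k \<le> i" "i < l" | "i = l" by linarith
    then show "u (e i) = w (e i)"
      using i u w by cases (auto simp: fixed vals last)
  qed (use u w even even_signed_linear in auto)
  then have "?P (longest_element e H)"
    unfolding longest_element_def using w by (intro theI[of ?P]) auto
  then show ?thesis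
    using vals last by auto
qed

lemma even_signed_Weyl_group:
  assumes "w \<in> Weyl_group e"
  shows "even_signed w"
proof -
  have "even_signed w \<and> bij w"
    using assms unfolding Weyl_group_def
    by (rule generate_involutions_induct[where P = even_signed])
      (auto intro: even_signed_id even_signed_comp even_signed_reflection reflection_involution)
  then show ?thesis ..
qed

lemma parabolic_subgroup_props:
  assumes "w \<in> parabolic_subgroup e {2..l}"
  shows "even_signed w \<and> w (e 1) = e 1"
proof -
  have refl1: "simple_reflection i (e 1) = e 1" if "2 \<le> i" "i \<le> l" for i
  proof -
    have "e 1 \<bullet> simple_root e i = 0"
      using that rank_ge
      by (cases "i = l") (auto simp: simple_root_less simple_root_last inner_simps)
    then show ?thesis by (simp add: reflection_def)
  qed
  have "(even_signed w \<and> w (e 1) = e 1) \<and> bij w"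
    using assms unfolding parabolic_subgroup_def
  proof (rule generate_involutions_induct[where P = "\<lambda>w. even_signed w \<and> w (e 1) = e 1"])
    fix g assume "g \<in> simple_reflection ` {2..l}"
    then show "g \<circ> g = id" "even_signed g \<and> g (e 1) = e 1"
      using refl1 by (auto intro!: reflection_involution simple_root_in even_signed_simple_reflection)
  qed (auto simp: even_signed_id even_signed_comp)
  then show ?thesis ..
qed

lemma omega_eq: "omega e 1 = (\<lambda>x. x - (2 * (x \<bullet> e 1)) *\<^sub>R e 1 - (2 * (x \<bullet> e l)) *\<^sub>R e l)"
proof -
  let ?w0 = "longest_element e (Weyl_group e)"
  let ?w1 = "longest_element e (parabolic_subgroup e {2..l})"
  have set: "{1..l} - {1} = {2..l}" by auto
  have omega: "omega e 1 = ?w1 \<circ> ?w0" by (simp add: omega_def rank set)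
  have one: "id \<in> generate (BijGroup UNIV) A" for A :: "(real ^ 'n \<Rightarrow> real ^ 'n) set"
    using generate.one[of "BijGroup UNIV" A] by (simp add: BijGroup_UNIV_one)
  have "?w0 \<in> Weyl_group e \<and> (\<forall>i \<in> {1..<l}. ?w0 (e i) = - e i) \<and>
      ?w0 (e l) = (-1) ^ (l - 1) *\<^sub>R e l"
  proof (rule longest_element_props)
    show "id \<in> Weyl_group e" unfolding Weyl_group_def by (rule one)
    show "w \<circ> simple_reflection i \<in> Weyl_group e"
      if "w \<in> Weyl_group e" "1 \<le> i" "i \<le> l" for w i
      using that unfolding Weyl_group_def
      by (intro generate_involutions_comp) (auto intro: simple_root_in reflection_involution)
  qed (use rank_ge even_signed_Weyl_group in auto)
  then have w0: "?w0 \<in> Weyl_group e" "\<And>i. 1 \<le> i \<Longrightarrow> i < l \<Longrightarrow> ?w0 (e i) = - e i"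
      "?w0 (e l) = (-1) ^ (l - 1) *\<^sub>R e l"
    by simp_all
  have "?w1 \<in> parabolic_subgroup e {2..l} \<and> (\<forall>i \<in> {2..<l}. ?w1 (e i) = - e i) \<and>
      ?w1 (e l) = (-1) ^ (l - 2) *\<^sub>R e l"
  proof (rule longest_element_props)
    show "id \<in> parabolic_subgroup e {2..l}" unfolding parabolic_subgroup_def by (rule one)
    show "w \<circ> simple_reflection i \<in> parabolic_subgroup e {2..l}"
      if "w \<in> parabolic_subgroup e {2..l}" "2 \<le> i" "i \<le> l" for w i
      using that unfolding parabolic_subgroup_def
      by (intro generate_involutions_comp) (auto intro!: simple_root_in reflection_involution)
    show "w (e i) = e i" if "w \<in> parabolic_subgroup e {2..l}" "1 \<le> i" "i < 2" for w i
    proof -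
      have "i = 1" using that by linarith
      then show ?thesis using parabolic_subgroup_props[OF that(1)] by simp
    qed
  qed (use rank_ge parabolic_subgroup_props in auto)
  then have w1: "?w1 \<in> parabolic_subgroup e {2..l}" "\<And>i. 2 \<le> i \<Longrightarrow> i < l \<Longrightarrow> ?w1 (e i) = - e i"
      "?w1 (e l) = (-1) ^ (l - 2) *\<^sub>R e l"
    by simp_all
  have lin0: "linear ?w0" using even_signed_linear even_signed_Weyl_group w0(1) by blast
  have lin1: "linear ?w1" using even_signed_linear parabolic_subgroup_props w1(1) by blast
  have w1_1: "?w1 (e 1) = e 1" using parabolic_subgroup_props w1(1) by blast
  show ?thesis
    unfolding omega
  proof (rule linear_basis_eqI)
    fix i assume i: "1 \<le> i" "i \<le> l"
    \<comment> \<open>The exponents of the two longest elements on \<open>e l\<close> have opposite parity.\<close>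
    have "l - 1 = Suc (l - 2)" using rank_ge by simp
    then have last: "(-1) ^ (l - 1) * (-1) ^ (l - 2) = (- 1 :: real)"
      by (simp flip: power_mult_distrib)
    consider "i = 1" | "2 \<le> i" "i < l" | "i = l" using i by linarith
    then show "(?w1 \<circ> ?w0) (e i) = e i - (2 * (e i \<bullet> e 1)) *\<^sub>R e 1 - (2 * (e i \<bullet> e l)) *\<^sub>R e l"
    proof cases
      case 1
      then show ?thesis using rank_ge w0(2)[of 1] by (simp add: linear_neg[OF lin1] w1_1 scaleR_2)
    next
      case 2
      then show ?thesis by (simp add: w0 w1 linear_neg[OF lin1])
    next
      case 3
      then show ?thesis
        using rank_ge last by (simp add: w0 w1 linear_scale[OF lin1] scaleR_2)
    qed
  next
    show "linear (\<lambda>x. x - (2 * (x \<bullet> e 1)) *\<^sub>R e 1 - (2 * (x \<bullet> e l)) *\<^sub>R e l)"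
      by (rule linearI) (auto simp: inner_simps algebra_simps)
  qed (use lin0 lin1 linear_compose in blast)
qed

lemma omega_twice: "omega e 1 (omega e 1 x) = x"
  using rank_ge by (simp add: omega_eq inner_simps algebra_simps)

lemma ord_omega: "group.ord (BijGroup UNIV) (omega e 1) = 2"
proof -
  interpret group "BijGroup (UNIV :: (real ^ 'n) set)" by (rule group_BijGroup)
  have inv: "omega e 1 \<circ> omega e 1 = id" by (simp add: fun_eq_iff omega_twice)
  have bij: "bij (omega e 1)" using bij_involution[OF inv] .
  then have car: "omega e 1 \<in> carrier (BijGroup UNIV)" by (simp add: carrier_BijGroup_UNIV)
  have "omega e 1 [^]\<^bsub>BijGroup UNIV\<^esub> (2::nat) = \<one>\<^bsub>BijGroup UNIV\<^esub>"
    using car by (simp add: numeral_2_eq_2 BijGroup_UNIV_mult bij inv BijGroup_UNIV_one)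
  then have "ord (omega e 1) dvd 2" using pow_eq_id[OF car] by simp
  then have "ord (omega e 1) \<le> 2" "ord (omega e 1) \<noteq> 0"
    by (simp add: dvd_imp_le, metis dvd_0_left_iff zero_neq_numeral)
  moreover have "ord (omega e 1) \<noteq> 1"
  proof
    assume "ord (omega e 1) = 1"
    then have "omega e 1 = id"
      using ord_eq_1[OF car] by (simp add: BijGroup_UNIV_one)
    then have "omega e 1 (e 1) \<bullet> e 1 = e 1 \<bullet> e 1" by simp
    then show False using rank_ge by (simp add: omega_eq inner_simps)
  qed
  ultimately show ?thesis by linarith
qed

lemma average_omega: "average (omega e 1) x = x - (x \<bullet> e 1) *\<^sub>R e 1 - (x \<bullet> e l) *\<^sub>R e l"
proof -
  have "{1..2::nat} = {1, 2}" by auto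
  then have "average (omega e 1) x = (1 / 2) *\<^sub>R (\<Sum>t \<in> {1, 2}. (omega e 1 ^^ t) x)"
    by (simp add: average_def ord_omega)
  also have "(\<Sum>t \<in> {1, 2}. (omega e 1 ^^ t) x) = omega e 1 x + x"
    by (simp add: numeral_2_eq_2 One_nat_def omega_twice[unfolded One_nat_def])
  also have "omega e 1 x + x = 2 *\<^sub>R (x - (x \<bullet> e 1) *\<^sub>R e 1 - (x \<bullet> e l) *\<^sub>R e l)"
    by (simp add: omega_eq scaleR_diff_right scaleR_2[of x] diff_add_eq)
  also have "(1 / 2) *\<^sub>R \<dots> = x - (x \<bullet> e 1) *\<^sub>R e 1 - (x \<bullet> e l) *\<^sub>R e l"
    by simp
  finally show ?thesis .
qed

lemma root_average_zero_iff:
  "\<beta> \<in> roots_D e \<and> average (omega e 1) \<beta> = 0 \<longleftrightarrow>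
    \<beta> \<in> {e 1 + e l, e 1 - e l, - e 1 + e l, - e 1 - e l}"
proof
  assume "\<beta> \<in> roots_D e \<and> average (omega e 1) \<beta> = 0"
  then obtain p q s t where pq: "1 \<le> p" "p < q" "q \<le> l" and st: "s \<in> {1, -1}" "t \<in> {1, -1}"
    and \<beta>: "\<beta> = s *\<^sub>R e p + t *\<^sub>R e q" and avg: "average (omega e 1) \<beta> = 0"
    unfolding root_iff by blast
  have coord: "\<beta> \<bullet> e i = 0" if "1 < i" "i < l" for i
  proof -
    have "average (omega e 1) \<beta> \<bullet> e i = \<beta> \<bullet> e i"
      using that by (simp add: average_omega inner_simps)
    then show ?thesis using avg by simp
  qed
  have "\<not> 1 < p"
  proof
    assume "1 < p"
    moreover have "p < l" using pq by linarith
    ultimately show False using coord[of p] pq st by (auto simp: \<beta> inner_simps)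
  qed
  then have "p = 1" using pq by linarith
  moreover have "\<not> q < l"
  proof
    assume "q < l"
    moreover have "1 < q" using pq by linarith
    ultimately show False using coord[of q] pq st by (auto simp: \<beta> inner_simps)
  qed
  then have "q = l" using pq by linarith
  ultimately show "\<beta> \<in> {e 1 + e l, e 1 - e l, - e 1 + e l, - e 1 - e l}"
    using st by (auto simp: \<beta>)
next
  assume \<beta>: "\<beta> \<in> {e 1 + e l, e 1 - e l, - e 1 + e l, - e 1 - e l}"
  have "\<beta> \<in> roots_D e"
    unfolding roots_D_def rank using \<beta> rank_ge by (intro UN_I[of "(1, l)"]) auto
  moreover have "average (omega e 1) \<beta> = 0"
    using \<beta> rank_ge by (auto simp: average_omega inner_simps)
  ultimately show "\<beta> \<in> roots_D e \<and> average (omega e 1) \<beta> = 0" ..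
qed

section \<open>The positive cone and the highest root\<close>

lemma cone_add:
  assumes "x \<in> nonneg_combinations e" "y \<in> nonneg_combinations e"
  shows "x + y \<in> nonneg_combinations e"
proof -
  obtain c d where "x = (\<Sum>i = 1..l. real (c i) *\<^sub>R simple_root e i)"
    "y = (\<Sum>i = 1..l. real (d i) *\<^sub>R simple_root e i)"
    using assms unfolding nonneg_combinations_def rank by blast
  then have "x + y = (\<Sum>i = 1..l. real (c i + d i) *\<^sub>R simple_root e i)"
    by (simp add: sum.distrib scaleR_add_left)
  then show ?thesis unfolding nonneg_combinations_def rank mem_Collect_eq by (intro exI[of _ "\<lambda>i. c i + d i"]) simp
qed

lemma cone_zero: "0 \<in> nonneg_combinations e"
  unfolding nonneg_combinations_def by (intro CollectI exI[of _ "\<lambda>_. 0"]) simp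

lemma cone_simple_root:
  assumes "1 \<le> i" "i \<le> l"
  shows "simple_root e i \<in> nonneg_combinations e"
proof -
  have "(\<Sum>j = 1..l. real (if j = i then 1 else 0) *\<^sub>R simple_root e j) =
      (\<Sum>j = 1..l. if j = i then simple_root e j else 0)"
    by (intro sum.cong) auto
  also have "\<dots> = simple_root e i" using assms by simp
  finally show ?thesis
    unfolding nonneg_combinations_def rank by (intro CollectI exI[of _ "\<lambda>j. if j = i then 1 else 0"]) simp
qed

lemma cone_diff:
  assumes "1 \<le> p" "p \<le> q" "q \<le> l"
  shows "e p - e q \<in> nonneg_combinations e"
  using assms(2,3)
proof (induction q rule: dec_induct)
  case base
  then show ?case by (simp add: cone_zero)
next
  case (step q)
  have "(e p - e q) + (e q - e (Suc q)) \<in> nonneg_combinations e"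
    using step assms(1) cone_simple_root[of q] by (intro cone_add) (auto simp: simple_root_less)
  then show ?case by simp
qed

lemma cone_sum:
  assumes "1 \<le> p" "p < q" "q \<le> l"
  shows "e p + e q \<in> nonneg_combinations e"
proof -
  \<comment> \<open>The last summand is \<open>\<alpha>\<^sub>l\<close>; the other two are possibly empty sums of consecutive simple roots.\<close>
  have "((e p - e (l - 1)) + (e q - e l)) + (e (l - 1) + e l) \<in> nonneg_combinations e"
    using assms cone_simple_root[of l]
    by (intro cone_add[OF cone_add] cone_diff) (auto simp: simple_root_last)
  then show ?thesis by simp
qed

lemma rho_combination:
  "rho \<bullet> (\<Sum>i = 1..l. real (c i) *\<^sub>R simple_root e i) = (\<Sum>i = 1..l. real (c i))"
  unfolding inner_sum_right by (intro sum.cong) (auto simp: rho_simple_root)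

lemma rho_cone: "x \<in> nonneg_combinations e \<Longrightarrow> 0 \<le> rho \<bullet> x"
  unfolding nonneg_combinations_def rank by (auto simp: rho_combination intro!: sum_nonneg)

text \<open>
  The heights of \<open>x\<close> and \<open>- x\<close> are nonnegative and opposite, hence zero; the height is the sum of
  the coefficients, so all of them vanish. This makes the highest root unique.
\<close>

lemma cone_pointed:
  assumes "x \<in> nonneg_combinations e" "- x \<in> nonneg_combinations e"
  shows "x = 0"
proof -
  obtain c where c: "x = (\<Sum>i = 1..l. real (c i) *\<^sub>R simple_root e i)"
    using assms unfolding nonneg_combinations_def rank by blast
  have "rho \<bullet> x = 0" using rho_cone[OF assms(1)] rho_cone[OF assms(2)] by simp
  then have "(\<Sum>i = 1..l. real (c i)) = 0" by (simp only: c rho_combination)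
  then have "\<forall>i \<in> {1..l}. real (c i) = 0" by (subst (asm) sum_nonneg_eq_0_iff) auto
  then show ?thesis by (simp add: c)
qed

lemma highest_root_eq: "highest_root e = e 1 + e 2"
  unfolding highest_root_def
proof (rule the_equality)
  have "e 1 + e 2 \<in> roots_D e" using rootI[of 1 2 1 1] rank_ge by simp
  moreover have "e 1 + e 2 - \<beta> \<in> nonneg_combinations e" if \<beta>: "\<beta> \<in> roots_D e" for \<beta>
  proof -
    obtain p q s t where pq: "1 \<le> p" "p < q" "q \<le> l"
      and "s \<in> {1, -1}" "t \<in> {1, -1}" "\<beta> = s *\<^sub>R e p + t *\<^sub>R e q"
      using \<beta> unfolding root_iff by blast
    then consider "\<beta> = e p + e q" | "\<beta> = e p - e q" | "\<beta> = - (e p - e q)" | "\<beta> = - (e p + e q)"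
      by auto
    then show ?thesis
    proof cases
      case 1
      have "(e 1 - e p) + (e 2 - e q) \<in> nonneg_combinations e"
        using pq by (intro cone_add cone_diff) auto
      then show ?thesis by (simp add: 1 algebra_simps)
    next
      case 2
      have "e 2 + e q \<in> nonneg_combinations e"
      proof (cases "q = 2")
        case True
        \<comment> \<open>Here \<open>2 * e 2\<close> is not a root, but it is the sum of two positive roots.\<close>
        have "(e 2 - e 3) + (e 2 + e 3) \<in> nonneg_combinations e"
          using rank_ge by (intro cone_add[OF cone_diff cone_sum]) auto
        then show ?thesis by (simp add: True)
      qed (use pq in \<open>auto intro: cone_sum\<close>)
      then have "(e 1 - e p) + (e 2 + e q) \<in> nonneg_combinations e"
        using pq by (intro cone_add[OF cone_diff]) auto
      then show ?thesis by (simp add: 2 algebra_simps)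
    next
      case 3
      have "(e 1 + e 2) + (e p - e q) \<in> nonneg_combinations e"
        using pq rank_ge by (intro cone_add[OF cone_sum cone_diff]) auto
      then show ?thesis by (simp add: 3 algebra_simps)
    next
      case 4
      have "(e 1 + e 2) + (e p + e q) \<in> nonneg_combinations e"
        using pq rank_ge by (intro cone_add[OF cone_sum cone_sum]) auto
      then show ?thesis by (simp add: 4 algebra_simps)
    qed
  qed
  ultimately show *: "e 1 + e 2 \<in> roots_D e \<and> (\<forall>\<beta> \<in> roots_D e. e 1 + e 2 - \<beta> \<in> nonneg_combinations e)"
    by blast
  fix \<theta> assume "\<theta> \<in> roots_D e \<and> (\<forall>\<beta> \<in> roots_D e. \<theta> - \<beta> \<in> nonneg_combinations e)"
  then show "\<theta> = e 1 + e 2"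
    using * cone_pointed[of "\<theta> - (e 1 + e 2)"] by simp
qed

section \<open>The orbit of the affine node and its coweight sum\<close>

text \<open>
  The first coordinate separates \<open>\<alpha>\<^sub>0\<close> and \<open>\<alpha>\<^sub>1\<close> from each other and from all other simple roots.
  This gives the uniqueness needed to evaluate the permutation of the indices at \<open>0\<close> and \<open>1\<close>, and it says that
  \<open>e 1\<close> is the first vector of the dual basis.
\<close>

lemma affine_root_coord:
  assumes "k \<le> l"
  shows "affine_root e k \<bullet> e 1 = (if k = 0 then -1 else if k = 1 then 1 else 0)"
proof -
  consider "k = 0" | "k = 1" | "2 \<le> k" "k < l" | "k = l" using assms by linarith
  then show ?thesis
    by cases (use rank_ge in
      \<open>auto simp: affine_root_def highest_root_eq simple_root_less simple_root_last inner_simps\<close>)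
qed

lemma index_perm_swap:
  "index_perm e (omega e 1) 0 = 1" "index_perm e (omega e 1) 1 = 0"
proof -
  have a0: "omega e 1 (affine_root e 0) = affine_root e 1"
    and a1: "omega e 1 (affine_root e 1) = affine_root e 0"
    using rank_ge
    by (auto simp: affine_root_def highest_root_eq simple_root_less omega_eq inner_simps
        numeral_2_eq_2 algebra_simps simp flip: scaleR_2)
  have coord: "affine_root e i \<bullet> e 1 = affine_root e k \<bullet> e 1" if "affine_root e i = affine_root e k"
    for i k using that by (rule arg_cong)
  have "k = 1" if "k \<le> l" "affine_root e 1 = affine_root e k" for k
    using coord[OF that(2)] that(1) rank_ge by (simp add: affine_root_coord split: if_splits)
  then show "index_perm e (omega e 1) 0 = 1"
    unfolding index_perm_def a0 rank using rank_ge by (auto intro!: the_equality)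
  have "k = 0" if "k \<le> l" "affine_root e 0 = affine_root e k" for k
    using coord[OF that(2)] that(1) rank_ge by (simp add: affine_root_coord split: if_splits)
  then show "index_perm e (omega e 1) 1 = 0"
    unfolding index_perm_def a1 rank using rank_ge by (auto intro!: the_equality)
qed

lemma orbit_index_perm: "orbit (index_perm e (omega e 1)) 0 = {0, 1}"
proof (intro equalityI subsetI)
  fix k assume "k \<in> orbit (index_perm e (omega e 1)) 0"
  then show "k \<in> {0, 1}"
    by induction (use index_perm_swap in auto)
next
  have "1 \<in> orbit (index_perm e (omega e 1)) 0"
    using orbit.base[of "index_perm e (omega e 1)" 0] by (simp add: index_perm_swap)
  moreover from orbit.step[OF this] have "0 \<in> orbit (index_perm e (omega e 1)) 0"
    by (simp only: index_perm_swap)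
  ultimately show "k \<in> orbit (index_perm e (omega e 1)) 0" if "k \<in> {0, 1}" for k
    using that by blast
qed

text \<open>
  The simple roots span the space, so a vector of the dual basis is unique.
\<close>

lemma orthogonal_simple_roots_zero:
  assumes "\<And>i. 1 \<le> i \<Longrightarrow> i \<le> l \<Longrightarrow> x \<bullet> simple_root e i = 0"
  shows "x = 0"
proof -
  have cone: "x \<bullet> y = 0" if y: "y \<in> nonneg_combinations e" for y
  proof -
    obtain c where "y = (\<Sum>i = 1..l. real (c i) *\<^sub>R simple_root e i)"
      using y unfolding nonneg_combinations_def rank by blast
    then show ?thesis using assms by (simp add: inner_sum_right)
  qed
  show ?thesis
  proof (rule basis_eqI)
    fix i assume i: "1 \<le> i" "i \<le> l"
    have "x \<bullet> e i = x \<bullet> e l" using cone[OF cone_diff[of i l]] i by (simp add: inner_simps)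
    moreover have "x \<bullet> e 1 = x \<bullet> e l" "x \<bullet> e 1 + x \<bullet> e l = 0"
      using cone[OF cone_diff[of 1 l]] cone[OF cone_sum[of 1 l]] rank_ge by (auto simp: inner_simps)
    ultimately show "x \<bullet> e i = 0 \<bullet> e i" by simp
  qed
qed

lemma coweight_1: "coweight e 1 = e 1"
proof -
  have e1: "e 1 \<bullet> simple_root e i = (if i = 1 then 1 else 0)" if "1 \<le> i" "i \<le> l" for i
  proof -
    have "e 1 \<bullet> simple_root e i = affine_root e i \<bullet> e 1"
      using that by (simp add: affine_root_def inner_commute)
    then show ?thesis using that by (simp add: affine_root_coord)
  qed
  have "(THE v. \<forall>i \<in> {1..l}. v \<bullet> simple_root e i = (if i = 1 then 1 else 0)) = e 1"
  proof (rule the_equality)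
    fix v assume v: "\<forall>i \<in> {1..l}. v \<bullet> simple_root e i = (if i = 1 then 1 else 0)"
    have "v - e 1 = 0"
      by (rule orthogonal_simple_roots_zero) (use v e1 in \<open>auto simp: inner_diff_left\<close>)
    then show "v = e 1" by simp
  qed (use e1 in auto)
  then show ?thesis by (simp add: coweight_def rank)
qed

lemma pi0_eq: "pi0 e 1 = e 1"
  using coweight_1 by (simp add: pi0_def orbit_index_perm coweight_def[of e 0])

section \<open>The roots of average zero and their pairings\<close>

lemma positive_roots_average_zero_eq:
  "positive_roots_average_zero e 1 = {e 1 - e l, e 1 + e l}"
proof -
  have "e 1 - e l \<in> nonneg_combinations e" "e 1 + e l \<in> nonneg_combinations e"
    using rank_ge by (auto intro: cone_diff cone_sum)
  moreover have "- e 1 + e l \<notin> nonneg_combinations e" "- e 1 - e l \<notin> nonneg_combinations e"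
    using rho_cone[of "- e 1 + e l"] rho_cone[of "- e 1 - e l"] rank_ge
    by (auto simp: inner_simps)
  ultimately show ?thesis
    using root_average_zero_iff unfolding positive_roots_average_zero_def positive_roots_def
    by blast
qed

lemma simple_root_sum:
  assumes "m < l"
  shows "(\<Sum>i = 1..m. simple_root e i) = e 1 - e (Suc m)"
  using assms by (induction m) (auto simp: simple_root_less One_nat_def)

lemma P0_eq: "P0 e 1 = {1, -1}"
proof -
  have "P0 e 1 = (\<lambda>\<gamma>. \<gamma> \<bullet> e 1) ` {e 1 + e l, e 1 - e l, - e 1 + e l, - e 1 - e l}"
    unfolding P0_def pi0_eq root_average_zero_iff by blast
  then show ?thesis using rank_ge by (simp add: inner_simps)
qed

end

theorem proposition5p10:
  fixes e :: "nat \<Rightarrow> real ^ 'n" and l :: nat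
  assumes rank: "CARD('n) = l" and rank_ge: "l \<ge> 4"
    and standard_basis: "bij_betw e {1..l} Basis"
  shows "positive_roots_average_zero e 1 = {e 1 - e l, e 1 + e l} \<and>
    {e 1 - e l, e 1 + e l} =
      {\<Sum>i = 1..l - 1. simple_root e i,
       (\<Sum>i = 1..l - 2. simple_root e i) + simple_root e l} \<and>
    P0 e 1 = {1, - 1}"
proof -
  interpret D_type e l
    by unfold_locales (use assms in auto)
  have "Suc (l - 2) = l - 1" using rank_ge by simp
  then have "(\<Sum>i = 1..l - 1. simple_root e i) = e 1 - e l"
    "(\<Sum>i = 1..l - 2. simple_root e i) + simple_root e l = e 1 + e l"
    using simple_root_sum[of "l - 1"] simple_root_sum[of "l - 2"] rank_ge
    by (auto simp: simple_root_last)
  then show ?thesis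
    using positive_roots_average_zero_eq P0_eq by simp
qed

end
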